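(* Let $\gamma$ be the standard Gaussian law $N(0,1)$ on $\mathbb{R}$, and let $\mu_n$ be the law of $S_n$ (the normalized symmetric binomial law). Let $g\in L^1(\gamma)$ be a real-valued function which is in $\mathcal{C}^1([0,\infty))$ and is strictly increasing on $[x_0,\infty)$ for some $x_0\ge0$. Then along the subsequence $N=4n^2$, $n\to\infty$, $$\int_0^\infty g\,d\mu_N\longrightarrow\int_0^\infty g\,d\gamma.$$
   Context: $S_n=\dfrac{X_1+\cdots+X_n-n/2}{\sqrt n/2}$, where $X_1,X_2,\dots$ are i.i.d. with $P(X_k=0)=P(X_k=1)=\frac12$. *)

theory Defs
  imports "HOL-Probability.Probability"
begin

definition normalized_sum :: "(nat \<Rightarrow> 'a \<Rightarrow> real) \<Rightarrow> nat \<Rightarrow> 'a \<Rightarrow> real" where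
  "normalized_sum X n \<omega> = ((\<Sum>k=1..n. X k \<omega>) - real n / 2) / (sqrt (real n) / 2)"

definition normalized_law :: "'a measure \<Rightarrow> (nat \<Rightarrow> 'a \<Rightarrow> real) \<Rightarrow> nat \<Rightarrow> real measure" where
  "normalized_law M X n = distr M borel (normalized_sum X n)"

text \<open>The class \<open>C\<^sup>1([0,\<infinity>))\<close>: the derivative at the endpoint 0 is one-sided. The library's
  \<open>C1_differentiable_on\<close> uses two-sided derivatives, so on \<open>{0..}\<close> it would also constrain the
  function to the left of 0.\<close>
definition C1_halfline :: "(real \<Rightarrow> real) \<Rightarrow> bool" where
  "C1_halfline g \<longleftrightarrow>
     (\<exists>g'. (\<forall>x\<in>{0..}. (g has_real_derivative g' x) (at x within {0..})) \<and> continuous_on {0..} g')"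

end

(* Split g on the half line at a large level R into the bounded function g(min x R) and the excess
   (g - g R) on [R, oo). The central limit theorem handles the bounded part, whose only
   discontinuity is at 0. The excess is nonnegative and nondecreasing, and its integral against
   mu_N is at most a constant, independent of N = 4 n^2 and R, times its integral against the
   normal law: the binomial weight at x = k/n is at most C phi((k+1)/n)/n, so the binomial sum is
   dominated by a lower Riemann sum of the Gaussian integral. The latter tends to 0 as R grows. *)
theory Submission
  imports Defs
begin

section \<open>Gaussian upper bounds for symmetric binomial coefficients\<close>

text \<open>The difference of the two sides vanishes at 0 and has derivative
  \<open>1 - (1 - 2 * x) * exp (2 * x)\<close>, which is nonnegative because
  \<open>1 - 2 * x\<close> is at most \<open>exp (- (2 * x))\<close>. Read as
  \<open>(1 - u) / (1 + u) <= exp (- (2 * u))\<close>, the inequality bounds the ratio of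
  consecutive binomial coefficients.\<close>

lemma one_minus_mult_exp_le:
  fixes u :: real
  assumes "0 \<le> u"
  shows "(1 - u) * exp (2 * u) \<le> 1 + u"
proof -
  let ?f = "\<lambda>u::real. (1 + u) - (1 - u) * exp (2 * u)"
  have "?f 0 \<le> ?f u"
  proof (rule DERIV_nonneg_imp_nondecreasing[OF assms])
    fix x :: real
    have "(?f has_real_derivative (1 - (1 - 2 * x) * exp (2 * x))) (at x)"
      by (auto intro!: derivative_eq_intros simp: algebra_simps)
    moreover have "(1 - 2 * x) * exp (2 * x) \<le> exp (- (2 * x)) * exp (2 * x)"
      using exp_ge_add_one_self[of "- (2 * x)"] by (intro mult_right_mono) auto
    then have "1 - (1 - 2 * x) * exp (2 * x) \<ge> 0"
      by (simp flip: exp_add)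
    ultimately show "\<exists>y. (?f has_real_derivative y) (at x) \<and> 0 \<le> y"
      by blast
  qed
  then show ?thesis
    by simp
qed

text \<open>Squaring removes the square root, so the induction stays rational: a step multiplies the
  left side by \<open>4 * (2 * m + 1) * (2 * m + 3) / (m + 1)^2\<close>, which is below 16 because
  \<open>(2 * m + 1) * (2 * m + 3) = 4 * (m + 1)^2 - 1\<close>.\<close>

lemma central_binomial_square_le:
  "(real ((2 * m) choose m))\<^sup>2 * (2 * real m + 1) \<le> 16 ^ m"
proof (induction m)
  case (Suc m)
  let ?c = "real ((2 * m) choose m)" and ?d = "real ((2 * Suc m) choose Suc m)"
  \<comment> \<open>Recurrence for central coefficients: absorption is used twice, linked by the
    symmetry of row \<open>2 * m + 1\<close> about its middle.\<close>
  have "Suc m * ((2 * Suc m) choose Suc m) = 2 * (2 * m + 1) * ((2 * m) choose m)"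
  proof -
    have "Suc m * ((2 * Suc m) choose Suc m) = 2 * Suc m * (Suc (2 * m) choose m)"
      using Suc_times_binomial[of m "Suc (2 * m)"] by (simp only: mult_Suc_right) simp
    also have "Suc (2 * m) choose m = Suc (2 * m) choose Suc m"
      by (subst binomial_symmetric) auto
    also have "2 * Suc m * \<dots> = 2 * (Suc m * \<dots>)"
      by (rule mult.assoc)
    also have "Suc m * (Suc (2 * m) choose Suc m) = Suc (2 * m) * ((2 * m) choose m)"
      by (rule Suc_times_binomial)
    finally show ?thesis
      by (simp only: mult.assoc Suc_eq_plus1)
  qed
  then have "real (Suc m * ((2 * Suc m) choose Suc m)) = real (2 * (2 * m + 1) * ((2 * m) choose m))"
    by (simp only:)
  then have d: "(real m + 1) * ?d = 2 * (2 * real m + 1) * ?c"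
    by (simp only: of_nat_mult of_nat_add of_nat_Suc of_nat_numeral of_nat_1 add.commute)
  have "(real m + 1)\<^sup>2 * (?d\<^sup>2 * (2 * real (Suc m) + 1)) = ((real m + 1) * ?d)\<^sup>2 * (2 * real m + 3)"
    by (simp add: power_mult_distrib)
  also have "\<dots> = (?c\<^sup>2 * (2 * real m + 1)) * (4 * (2 * real m + 1) * (2 * real m + 3))"
    unfolding d by (simp add: power2_eq_square) (simp add: algebra_simps)
  also have "\<dots> \<le> 16 ^ m * (16 * (real m + 1)\<^sup>2)"
  proof (rule mult_mono[OF Suc])
    show "4 * (2 * real m + 1) * (2 * real m + 3) \<le> 16 * (real m + 1)\<^sup>2"
      by (simp add: power2_eq_square algebra_simps)
  qed auto
  also have "\<dots> = (real m + 1)\<^sup>2 * 16 ^ Suc m"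
    by simp
  finally show ?case
    by (rule mult_left_le_imp_le) simp
qed simp

lemma central_binomial_le:
  "real ((2 * m) choose m) / 4 ^ m \<le> 1 / sqrt (2 * real m + 1)"
proof -
  have "(real ((2 * m) choose m) * sqrt (2 * real m + 1))\<^sup>2 \<le> (4 ^ m)\<^sup>2"
  proof -
    have "(4 ^ m :: real)\<^sup>2 = 16 ^ m"
      by (simp add: power2_eq_square flip: power_mult_distrib)
    then show ?thesis
      using central_binomial_square_le[of m] by (simp add: power_mult_distrib)
  qed
  then have "real ((2 * m) choose m) * sqrt (2 * real m + 1) \<le> 4 ^ m"
    by (rule power2_le_imp_le) simp
  then show ?thesis
    by (simp add: field_simps)
qed

text \<open>Each step away from the centre multiplies the coefficient by
  \<open>(m - k) / (m + k + 1)\<close>, which is at most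
  \<open>exp (- (2 * k + 1) / (m + 1 / 2))\<close>. The odd numbers in the exponents add up to a
  square, so the exponent comes out exactly.\<close>

lemma binomial_le_central_gaussian:
  assumes "k \<le> m"
  shows "real ((2 * m) choose (m + k)) \<le> real ((2 * m) choose m) * exp (- (real k)\<^sup>2 / (real m + 1 / 2))"
  using assms
proof (induction k)
  case (Suc k)
  \<comment> \<open>With this \<open>u\<close> the ratio \<open>(m - k) / (m + k + 1)\<close> of
    consecutive coefficients equals \<open>(1 - u) / (1 + u)\<close>.\<close>
  define u where "u = (2 * real k + 1) / (2 * real m + 1)"
  let ?b = "\<lambda>k. real ((2 * m) choose (m + k))"
  have "Suc (m + k) * ((2 * m) choose Suc (m + k)) = (2 * m - (m + k)) * ((2 * m) choose (m + k))"
    by (metis binomial_absorb_comp binomial_absorption mult.commute)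
  then have "real (Suc (m + k) * ((2 * m) choose Suc (m + k))) = real ((2 * m - (m + k)) * ((2 * m) choose (m + k)))"
    by (simp only:)
  then have step: "(real m + real k + 1) * ?b (Suc k) = (real m - real k) * ?b k"
    using Suc.prems by (simp add: of_nat_diff algebra_simps)
  have "(1 - u) * exp (2 * u) \<le> 1 + u"
    by (rule one_minus_mult_exp_le) (simp add: u_def)
  then have "(2 * real m + 1) * ((1 - u) * exp (2 * u)) \<le> (2 * real m + 1) * (1 + u)"
    by (intro mult_left_mono) auto
  moreover have "(2 * real m + 1) * u = 2 * real k + 1"
    by (simp add: u_def add_nonneg_eq_0_iff)
  then have "(2 * real m + 1) * (1 - u) = 2 * (real m - real k)"
    "(2 * real m + 1) * (1 + u) = 2 * (real m + real k + 1)"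
    by (simp_all add: right_diff_distrib distrib_left)
  ultimately have "2 * (real m - real k) * exp (2 * u) \<le> 2 * (real m + real k + 1)"
    by (simp only: mult.assoc[symmetric])
  then have "2 * ((real m - real k) * exp (2 * u)) \<le> 2 * (real m + real k + 1)"
    by (simp only: mult.assoc)
  then have "(real m - real k) * exp (2 * u) \<le> real m + real k + 1"
    by (rule mult_left_le_imp_le) simp
  then have ratio: "real m - real k \<le> (real m + real k + 1) * exp (- (2 * u))"
    by (simp add: exp_minus field_simps)
  have e: "- (real k)\<^sup>2 / (real m + 1 / 2) - 2 * u = - (real (Suc k))\<^sup>2 / (real m + 1 / 2)"
  proof -
    have "2 * u = (2 * real k + 1) / (real m + 1 / 2)"
      by (simp add: u_def divide_simps)
    moreover have "(real (Suc k))\<^sup>2 = (real k)\<^sup>2 + (2 * real k + 1)"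
      by (simp add: power2_eq_square algebra_simps)
    ultimately show ?thesis
      by (simp add: add_divide_distrib diff_divide_distrib)
  qed
  have "(real m + real k + 1) * ?b (Suc k) = (real m - real k) * ?b k"
    by (rule step)
  also have "\<dots> \<le> ((real m + real k + 1) * exp (- (2 * u))) *
      (real ((2 * m) choose m) * exp (- (real k)\<^sup>2 / (real m + 1 / 2)))"
    using Suc ratio by (intro mult_mono) auto
  also have "\<dots> = (real m + real k + 1) * (real ((2 * m) choose m) * exp (- (real k)\<^sup>2 / (real m + 1 / 2) - 2 * u))"
    unfolding diff_conv_add_uminus[of _ "2 * u"] exp_add by (simp only: mult_ac)
  finally show ?case
    unfolding e by (rule mult_left_le_imp_le) simp
qed simp

text \<open>The exponent involves \<open>k + 1\<close> instead of \<open>k\<close> at the price of a constant factor only,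
  because the lattice \<open>k / n\<close> has mesh \<open>1 / n\<close> and stays below \<open>2 * n\<close>.\<close>

lemma symmetric_binomial_weight_le:
  fixes n k :: nat
  assumes "n \<ge> 1" "k \<le> 2 * n\<^sup>2"
  shows "real ((4 * n\<^sup>2) choose (2 * n\<^sup>2 + k)) / 2 ^ (4 * n\<^sup>2)
    \<le> exp 3 / (2 * real n) * exp (- ((real k + 1) / real n)\<^sup>2 / 2)"
proof -
  define m where "m = 2 * n\<^sup>2"
  have m: "real m = 2 * (real n)\<^sup>2" "m \<ge> 1" "k \<le> m" "4 * n\<^sup>2 = 2 * m"
    using assms by (auto simp: m_def Suc_le_eq)
  \<comment> \<open>Replacing \<open>m + 1 / 2\<close> by \<open>m\<close> in the exponent costs at
    most 1/2, since k \<le> m.\<close>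
  have "- (real k)\<^sup>2 / (real m + 1 / 2) \<le> 1 / 2 - (real k)\<^sup>2 / real m"
  proof -
    have k: "(real k)\<^sup>2 \<le> (real m)\<^sup>2"
      using m by (intro power_mono) auto
    have "(real k)\<^sup>2 / real m - (real k)\<^sup>2 / (real m + 1 / 2) = (real k)\<^sup>2 / (real m * (2 * real m + 1))"
      using m(2) by (simp add: divide_simps) (simp add: algebra_simps)
    moreover have "(real k)\<^sup>2 / (real m * (2 * real m + 1)) \<le> 1 / 2"
    proof -
      have "(real m)\<^sup>2 * 2 \<le> real m * (2 * real m + 1)"
        by (simp add: power2_eq_square algebra_simps)
      with k have "(real k)\<^sup>2 * 2 \<le> real m * (2 * real m + 1)"
        by linarith
      then show ?thesis
        using m(2) by (simp add: divide_simps)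
    qed
    ultimately show ?thesis
      by linarith
  qed
  moreover have "((real k + 1) / real n)\<^sup>2 / 2 = (real k + 1)\<^sup>2 / real m"
    by (simp add: m power_divide)
  \<comment> \<open>Moving from \<open>k\<close> to \<open>k + 1\<close> costs
    \<open>(2 * k + 1) / m\<close>, at most 2 + 1/2 for \<open>m >= 2\<close>; the case
    \<open>m = 1\<close> is impossible because \<open>m = 2 * n^2\<close> is even. Together with the
    previous 1/2 this gives the constant \<open>exp 3\<close>.\<close>
  moreover have "(real k + 1)\<^sup>2 / real m \<le> (real k)\<^sup>2 / real m + 5 / 2"
  proof (cases "m = 1")
    case True
    then show ?thesis using m by (simp add: m_def)
  next
    case False
    then have "m \<ge> 2" using m by simp
    then have "2 * real k + 1 \<le> 5 / 2 * real m"
      using m(3) by linarith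
    then have "(2 * real k + 1) / real m \<le> 5 / 2"
      using m(2) by (simp add: divide_simps)
    then show ?thesis
      by (simp add: power2_sum add_divide_distrib)
  qed
  ultimately have expo: "- (real k)\<^sup>2 / (real m + 1 / 2) \<le> 3 + - ((real k + 1) / real n)\<^sup>2 / 2"
    by linarith
  have "real ((4 * n\<^sup>2) choose (2 * n\<^sup>2 + k)) / 2 ^ (4 * n\<^sup>2) = real ((2 * m) choose (m + k)) / 4 ^ m"
    by (simp add: m(4) power_mult) (simp add: m_def)
  also have "\<dots> \<le> real ((2 * m) choose m) * exp (- (real k)\<^sup>2 / (real m + 1 / 2)) / 4 ^ m"
    by (intro divide_right_mono binomial_le_central_gaussian m) auto
  also have "\<dots> = real ((2 * m) choose m) / 4 ^ m * exp (- (real k)\<^sup>2 / (real m + 1 / 2))"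
    by simp
  also have "\<dots> \<le> (1 / (2 * real n)) * exp (3 + - ((real k + 1) / real n)\<^sup>2 / 2)"
  proof (intro mult_mono)
    \<comment> \<open>Here \<open>2 * m\<close> is the perfect square \<open>(2 * n)^2\<close>, so
      the central weight is at most \<open>1 / (2 * n)\<close>.\<close>
    have "2 * real n \<le> sqrt (2 * real m + 1)"
      unfolding m by (intro real_le_rsqrt) (simp add: power_mult_distrib)
    then have "1 / sqrt (2 * real m + 1) \<le> 1 / (2 * real n)"
      using assms by (intro divide_left_mono mult_pos_pos) auto
    with central_binomial_le[of m] show "real ((2 * m) choose m) / 4 ^ m \<le> 1 / (2 * real n)"
      by linarith
    show "exp (- (real k)\<^sup>2 / (real m + 1 / 2)) \<le> exp (3 + - ((real k + 1) / real n)\<^sup>2 / 2)"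
      using expo by simp
  qed auto
  also have "\<dots> = exp 3 / (2 * real n) * exp (- ((real k + 1) / real n)\<^sup>2 / 2)"
    by (simp only: exp_add) simp
  finally show ?thesis .
qed

section \<open>Comparison of binomial sums with Gaussian integrals\<close>

lemma std_normal_density_antimono:
  assumes "0 \<le> x" "x \<le> y"
  shows "std_normal_density y \<le> std_normal_density x"
  using power_mono[OF assms(2,1), of 2] by (simp add: std_normal_density_def divide_right_mono)

text \<open>On the cell from \<open>k / n\<close> to \<open>(k + 1) / n\<close> the nondecreasing
  \<open>h\<close> is smallest at the left end and the density at the right end. The product of
  these two values times the width \<open>1 / n\<close> is therefore at most the integral over the
  cell; the cells are disjoint and the rest of the line contributes a nonnegative amount.\<close>

lemma riemann_sum_le_normal_integral:
  fixes h :: "real \<Rightarrow> real"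
  assumes "n \<ge> 1" and int: "integrable std_normal_distribution h"
    and mono: "mono h" and nonneg: "\<And>x. 0 \<le> h x"
  shows "(\<Sum>k\<le>K. h (real k / real n) * (std_normal_density ((real k + 1) / real n) / real n))
    \<le> (LINT x|std_normal_distribution. h x)"
proof -
  define c where "c k = h (real k / real n) * std_normal_density ((real k + 1) / real n)" for k
  define J where "J k = {real k / real n ..< (real k + 1) / real n}" for k
  have J: "J k \<in> sets lborel" "emeasure lborel (J k) < \<infinity>" "measure lborel (J k) = 1 / real n" for k
  proof -
    have "real k / real n \<le> (real k + 1) / real n"
      by (intro divide_right_mono) auto
    then show "J k \<in> sets lborel" "emeasure lborel (J k) < \<infinity>" "measure lborel (J k) = 1 / real n"
      by (simp_all add: J_def) (simp add: add_divide_distrib)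
  qed
  have [measurable]: "h \<in> borel_measurable borel"
    using int by (simp add: borel_measurable_integrable[of std_normal_distribution, simplified])
  have intd: "integrable lborel (\<lambda>x. std_normal_density x * h x)"
    using int by (simp add: integrable_density)
  have intJ: "integrable lborel (\<lambda>x. c k * indicator (J k) x :: real)" for k
    using J by (intro integrable_mult_right integrable_real_indicator) simp_all
  have step: "(\<Sum>k\<le>K. c k * indicator (J k) x) \<le> std_normal_density x * h x" for x
  proof (cases "\<exists>k. x \<in> J k")
    case True
    then obtain k where k: "x \<in> J k"
      by blast
    \<comment> \<open>The cells are half-open, so a point lies in at most one of them.\<close>
    have "l = k" if "x \<in> J l" for l
    proof -
      have "real l \<le> x * n" "x * n < real l + 1" "real k \<le> x * n" "x * n < real k + 1"
        using k that \<open>n \<ge> 1\<close> by (auto simp: J_def field_simps)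
      then show ?thesis
        by linarith
    qed
    then have "x \<in> J l \<longleftrightarrow> l = k" for l
      using k by blast
    then have "(\<Sum>k\<le>K. c k * indicator (J k) x) = (\<Sum>l\<le>K. if l = k then c k else 0)"
      by (intro sum.cong) (simp_all add: indicator_def)
    \<comment> \<open>Equality holds for k \<le> K; for larger \<open>k\<close> the sum is 0 and
      nonnegativity of \<open>c k\<close> is used.\<close>
    also have "\<dots> \<le> c k"
      using nonneg by (simp add: c_def)
    also have "c k \<le> h x * std_normal_density x"
    proof -
      have "real k / real n \<le> x" "x \<le> (real k + 1) / real n"
        using k by (auto simp: J_def)
      moreover from this have "0 \<le> x"
        by (meson divide_nonneg_nonneg of_nat_0_le_iff order_trans)
      ultimately show ?thesis
        unfolding c_def using nonneg
        by (intro mult_mono monoD[OF mono] std_normal_density_antimono) auto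
    qed
    finally show ?thesis
      by (simp add: mult.commute)
  next
    case False
    then show ?thesis
      using nonneg by simp
  qed
  have "(\<Sum>k\<le>K. h (real k / real n) * (std_normal_density ((real k + 1) / real n) / real n)) =
      (\<Sum>k\<le>K. LINT x|lborel. c k * indicator (J k) x)"
  proof (intro sum.cong refl)
    fix k
    show "h (real k / real n) * (std_normal_density ((real k + 1) / real n) / real n) =
        (LINT x|lborel. c k * indicator (J k) x)"
      using J by (simp add: c_def)
  qed
  also have "\<dots> = (LINT x|lborel. (\<Sum>k\<le>K. c k * indicator (J k) x))"
    using intJ by (intro Bochner_Integration.integral_sum[symmetric])
  also have "\<dots> \<le> (LINT x|lborel. std_normal_density x * h x)"
    using intJ intd step by (intro integral_mono Bochner_Integration.integrable_sum) auto
  also have "\<dots> = (LINT x|std_normal_distribution. h x)"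
    by (simp add: integral_density)
  finally show ?thesis .
qed

text \<open>The left side is the integral of \<open>h\<close> against the law of the normalized sum
  of \<open>4 * n^2\<close> coins, whose atoms are the points \<open>(j - 2 * n^2) / n\<close>. The
  pointwise weight bound turns it into the lower Riemann sum above, with a constant that does not
  depend on \<open>n\<close> or \<open>h\<close>.\<close>

lemma binomial_integral_le_normal_integral:
  fixes h :: "real \<Rightarrow> real"
  assumes "n \<ge> 1" and int: "integrable std_normal_distribution h"
    and mono: "mono h" and nonneg: "\<And>x. 0 \<le> h x" and neg: "\<And>x. x < 0 \<Longrightarrow> h x = 0"
  shows "(\<Sum>j\<le>4 * n\<^sup>2. real ((4 * n\<^sup>2) choose j) * h ((real j - 2 * (real n)\<^sup>2) / real n)) / 2 ^ (4 * n\<^sup>2)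
    \<le> exp 3 * sqrt (2 * pi) / 2 * (LINT x|std_normal_distribution. h x)"
proof -
  define m where "m = 2 * n\<^sup>2"
  have m: "real m = 2 * (real n)\<^sup>2" "4 * n\<^sup>2 = 2 * m" "m \<le> 2 * m" "2 * m - m = m"
    by (simp_all add: m_def)
  let ?F = "\<lambda>j. real ((2 * m) choose j) * h ((real j - real m) / real n)"
  \<comment> \<open>Indices below the centre \<open>m\<close> give negative atoms, where
    \<open>h\<close> vanishes.\<close>
  have "(\<Sum>j\<le>2 * m. ?F j) = (\<Sum>j\<in>{m..2 * m}. ?F j)"
    using \<open>n \<ge> 1\<close> by (intro sum.mono_neutral_right) (auto intro!: neg simp: field_simps not_le)
  also have "\<dots> = (\<Sum>k\<le>m. ?F (m + k))"
    using sum.atLeastAtMost_shift_0[OF m(3), of ?F] by (simp add: m(4) comp_def atLeast0AtMost)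
  finally have "(\<Sum>j\<le>2 * m. ?F j) / 2 ^ (2 * m) =
      (\<Sum>k\<le>m. real ((2 * m) choose (m + k)) / 2 ^ (2 * m) * h (real k / real n))"
    by (simp add: sum_divide_distrib)
  \<comment> \<open>The factor \<open>sqrt (2 * pi)\<close> undoes the normalization of the density;
    \<open>exp 3 / 2\<close> comes from the weight bound.\<close>
  also have "\<dots> \<le> (\<Sum>k\<le>m. exp 3 * sqrt (2 * pi) / 2 *
      (h (real k / real n) * (std_normal_density ((real k + 1) / real n) / real n)))"
  proof (rule sum_mono)
    fix k assume "k \<in> {..m}"
    then have "real ((2 * m) choose (m + k)) / 2 ^ (2 * m) * h (real k / real n)
      \<le> exp 3 / (2 * real n) * exp (- ((real k + 1) / real n)\<^sup>2 / 2) * h (real k / real n)"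
      using symmetric_binomial_weight_le[OF \<open>n \<ge> 1\<close>, of k] nonneg
      by (intro mult_right_mono) (auto simp: m_def)
    also have "\<dots> = exp 3 * sqrt (2 * pi) / 2 *
      (h (real k / real n) * (std_normal_density ((real k + 1) / real n) / real n))"
      by (simp add: std_normal_density_def)
    finally show "real ((2 * m) choose (m + k)) / 2 ^ (2 * m) * h (real k / real n) \<le> \<dots>" .
  qed
  also have "\<dots> = exp 3 * sqrt (2 * pi) / 2 * (\<Sum>k\<le>m.
      h (real k / real n) * (std_normal_density ((real k + 1) / real n) / real n))"
    by (rule sum_distrib_left[symmetric])
  also have "\<dots> \<le> exp 3 * sqrt (2 * pi) / 2 * (LINT x|std_normal_distribution. h x)"
    by (intro mult_left_mono riemann_sum_le_normal_integral assms) auto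
  finally show ?thesis
    by (simp only: m)
qed

section \<open>Decomposition of the integrand at the level \<open>R\<close>\<close>

text \<open>Subtracting \<open>g R\<close> makes the function start at 0, so for \<open>g\<close>
  nondecreasing from \<open>R\<close> on it is nonnegative and nondecreasing on the whole line, as
  the Riemann sum comparison requires.\<close>

definition tail_excess :: "(real \<Rightarrow> real) \<Rightarrow> real \<Rightarrow> real \<Rightarrow> real" where
  "tail_excess g R x = (if R \<le> x then g x - g R else 0)"

lemma tail_excess_nonneg: "mono_on {R..} g \<Longrightarrow> 0 \<le> tail_excess g R x"
  by (auto simp: tail_excess_def mono_on_def)

lemma mono_tail_excess: "mono_on {R..} g \<Longrightarrow> mono (tail_excess g R)"
  by (auto simp: tail_excess_def mono_on_def intro!: monoI)

lemma tail_excess_measurable [measurable]: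
  assumes [measurable]: "g \<in> borel_measurable borel"
  shows "tail_excess g R \<in> borel_measurable borel"
  unfolding tail_excess_def[abs_def] by measurable

lemma integrable_tail_excess:
  assumes "prob_space P" and [simp]: "sets P = sets borel" and int: "integrable P g"
  shows "integrable P (tail_excess g R)"
proof -
  interpret prob_space P by fact
  note meas_eq = measurable_cong_sets[OF assms(2) refl]
  have "g \<in> borel_measurable borel"
    using borel_measurable_integrable[OF int] unfolding meas_eq .
  then have "tail_excess g R \<in> borel_measurable P"
    unfolding meas_eq by (rule tail_excess_measurable)
  then show ?thesis
  proof (rule Bochner_Integration.integrable_bound[rotated])
    show "integrable P (\<lambda>x. \<bar>g x\<bar> + \<bar>g R\<bar>)"
      using int by simp
  qed (auto simp: tail_excess_def)
qed

text \<open>Dominated convergence: at a fixed point the excess is 0 once the level has passed it,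
  and by monotonicity of \<open>g\<close> raising the level only decreases the excess, so the one at
  level \<open>r\<close> dominates all others.\<close>

lemma integral_tail_excess_tendsto_0:
  assumes "prob_space P" and [simp]: "sets P = sets borel" and int: "integrable P g"
    and mono: "mono_on {r..} g"
  shows "(\<lambda>i. LINT x|P. tail_excess g (r + real i) x) \<longlonglongrightarrow> 0"
proof -
  have meas: "tail_excess g R \<in> borel_measurable P" for R
    using integrable_tail_excess[OF assms(1-3)] by (rule borel_measurable_integrable)
  have "(\<lambda>i. LINT x|P. tail_excess g (r + real i) x) \<longlonglongrightarrow> (LINT x|P. 0)"
  proof (rule integral_dominated_convergence[where w = "tail_excess g r"])
    show "integrable P (tail_excess g r)"
      by (rule integrable_tail_excess) fact+
    show "AE x in P. (\<lambda>i. tail_excess g (r + real i) x) \<longlonglongrightarrow> 0"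
    proof (rule AE_I2)
      fix x
      obtain N :: nat where "x - r < real N"
        using reals_Archimedean2 by blast
      then have "\<forall>\<^sub>F i in sequentially. tail_excess g (r + real i) x = 0"
        by (intro eventually_sequentiallyI[of N]) (auto simp: tail_excess_def)
      then show "(\<lambda>i. tail_excess g (r + real i) x) \<longlonglongrightarrow> 0"
        by (rule tendsto_eventually)
    qed
    show "AE x in P. norm (tail_excess g (r + real i) x) \<le> tail_excess g r x" for i
      using mono by (intro AE_I2) (auto simp: tail_excess_def mono_on_def)
  qed (auto intro: meas)
  then show ?thesis
    by simp
qed

text \<open>Beyond \<open>R\<close> the value is frozen at \<open>g R\<close> instead of being cut
  to 0. This avoids a jump at \<open>R\<close>, so for \<open>g\<close> continuous on the half line
  the only possible discontinuity is at 0.\<close>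

definition halfline_truncation :: "(real \<Rightarrow> real) \<Rightarrow> real \<Rightarrow> real \<Rightarrow> real" where
  "halfline_truncation g R x = indicator {0..} x * g (min x R)"

lemma halfline_truncation_plus_tail_excess:
  "0 \<le> R \<Longrightarrow> indicator {0..} x * g x = halfline_truncation g R x + tail_excess g R x"
  by (auto simp: halfline_truncation_def tail_excess_def indicator_def min_def)

lemma halfline_truncation_measurable [measurable]:
  assumes [measurable]: "g \<in> borel_measurable borel"
  shows "halfline_truncation g R \<in> borel_measurable borel"
  unfolding halfline_truncation_def[abs_def] by measurable

lemma isCont_halfline_truncation:
  assumes "continuous_on {0..} g" "0 \<le> R" "x \<noteq> 0"
  shows "isCont (halfline_truncation g R) x"
proof (cases "x < 0")
  case True
  have "continuous_on {..<0} (halfline_truncation g R)"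
    by (rule continuous_on_eq[of _ "\<lambda>_. 0"]) (auto simp: halfline_truncation_def)
  with True show ?thesis
    by (simp add: continuous_on_eq_continuous_at)
next
  case False
  have "continuous_on {0<..} (\<lambda>x. g (min x R))"
    using assms by (intro continuous_on_compose2[OF assms(1)]) (auto intro!: continuous_intros)
  then have "continuous_on {0<..} (halfline_truncation g R)"
    by (rule continuous_on_eq) (auto simp: halfline_truncation_def)
  then show ?thesis
    using False assms(3) by (simp add: continuous_on_eq_continuous_at)
qed

lemma bounded_halfline_truncation:
  assumes "continuous_on {0..} g" "0 \<le> R"
  obtains B where "\<And>x. norm (halfline_truncation g R x) \<le> B"
proof -
  have "bounded (g ` {0..R})"
    by (intro compact_imp_bounded compact_continuous_image continuous_on_subset[OF assms(1)]) auto
  \<comment> \<open>Positivity of \<open>B\<close> covers negative arguments, where the truncation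
    is 0.\<close>
  then obtain B where "\<And>x. x \<in> {0..R} \<Longrightarrow> norm (g x) \<le> B" and "0 < B"
    unfolding bounded_pos by blast
  with assms(2) show ?thesis
    by (intro that[of B]) (auto simp: halfline_truncation_def indicator_def)
qed


section \<open>The law of a sum of fair coins\<close>

text \<open>The level sets over \<open>A\<close> are disjoint and carry total mass 1, so
  \<open>Y\<close> lies in \<open>A\<close> almost surely, and \<open>f\<close> of \<open>Y\<close>
  agrees almost everywhere with a finite combination of indicators of these level sets.\<close>

lemma (in prob_space)
  fixes Y :: "'a \<Rightarrow> 'b" and f :: "'b \<Rightarrow> real"
  assumes A: "finite A" and Y: "\<And>a. a \<in> A \<Longrightarrow> {\<omega> \<in> space M. Y \<omega> = a} \<in> events"
    and total: "(\<Sum>a\<in>A. prob {\<omega> \<in> space M. Y \<omega> = a}) = 1"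
  shows AE_finite_support: "AE \<omega> in M. Y \<omega> \<in> A"
    and integrable_finite_support:
      "(\<lambda>\<omega>. f (Y \<omega>)) \<in> borel_measurable M \<Longrightarrow> integrable M (\<lambda>\<omega>. f (Y \<omega>))"
    and expectation_finite_support:
      "(\<lambda>\<omega>. f (Y \<omega>)) \<in> borel_measurable M \<Longrightarrow> expectation (\<lambda>\<omega>. f (Y \<omega>)) = (\<Sum>a\<in>A. f a * prob {\<omega> \<in> space M. Y \<omega> = a})"
proof -
  let ?E = "\<lambda>a. {\<omega> \<in> space M. Y \<omega> = a}"
  have "prob (\<Union>a\<in>A. ?E a) = 1"
    using A Y by (subst finite_measure_finite_Union) (auto simp: total disjoint_family_on_def)
  moreover have "(\<Union>a\<in>A. ?E a) \<in> events"
    using A Y by (intro sets.finite_UN) auto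
  ultimately have "AE \<omega> in M. \<omega> \<in> (\<Union>a\<in>A. ?E a)"
    by (subst AE_in_set_eq_1)
  then show AE: "AE \<omega> in M. Y \<omega> \<in> A"
    by eventually_elim auto
  assume f: "(\<lambda>\<omega>. f (Y \<omega>)) \<in> borel_measurable M"
  have eq: "AE \<omega> in M. (\<Sum>a\<in>A. f a * indicator (?E a) \<omega>) = f (Y \<omega>)"
  proof (rule AE_mp[OF AE], rule AE_I2, rule impI)
    fix \<omega> assume "\<omega> \<in> space M" "Y \<omega> \<in> A"
    then have "(\<Sum>a\<in>A. f a * indicator (?E a) \<omega>) = (\<Sum>a\<in>A. if a = Y \<omega> then f a else 0)"
      by (intro sum.cong) (auto simp: indicator_def)
    then show "(\<Sum>a\<in>A. f a * indicator (?E a) \<omega>) = f (Y \<omega>)"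
      using A \<open>Y \<omega> \<in> A\<close> by simp
  qed
  have int: "integrable M (\<lambda>\<omega>. \<Sum>a\<in>A. f a * indicator (?E a) \<omega> :: real)"
    using Y by (intro Bochner_Integration.integrable_sum integrable_mult_right)
      (auto intro!: integrable_real_indicator simp: emeasure_eq_measure)
  show "integrable M (\<lambda>\<omega>. f (Y \<omega>))"
    using integrable_cong_AE_imp[OF int f eq] .
  have "expectation (\<lambda>\<omega>. f (Y \<omega>)) = expectation (\<lambda>\<omega>. \<Sum>a\<in>A. f a * indicator (?E a) \<omega>)"
    using eq int f by (intro integral_cong_AE) auto
  also have "\<dots> = (\<Sum>a\<in>A. expectation (\<lambda>\<omega>. f a * indicator (?E a) \<omega>))"
    using Y by (intro Bochner_Integration.integral_sum integrable_mult_right)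
      (auto intro!: integrable_real_indicator simp: emeasure_eq_measure)
  also have "\<dots> = (\<Sum>a\<in>A. f a * prob (?E a))"
    by (intro sum.cong refl) (simp add: Collect_conj_eq Int_commute Int_left_commute)
  finally show "expectation (\<lambda>\<omega>. f (Y \<omega>)) = (\<Sum>a\<in>A. f a * prob (?E a))" .
qed

text \<open>Pascal's rule in summed form. It is the effect of one more coin on a binomial sum: the
  value at \<open>j\<close> is replaced by the values at \<open>j\<close> and
  \<open>j + 1\<close>.\<close>

lemma sum_binomial_Suc:
  fixes f :: "nat \<Rightarrow> 'b::comm_semiring_1"
  shows "(\<Sum>j\<le>Suc n. of_nat (Suc n choose j) * f j) = (\<Sum>j\<le>n. of_nat (n choose j) * (f j + f (Suc j)))"
proof -
  have "(\<Sum>j\<le>Suc n. of_nat (Suc n choose j) * f j) =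
      f 0 + (\<Sum>j\<le>n. of_nat (n choose Suc j) * f (Suc j)) + (\<Sum>j\<le>n. of_nat (n choose j) * f (Suc j))"
    by (simp add: sum.atMost_Suc_shift distrib_right sum.distrib add_ac del: sum.atMost_Suc)
  also have "f 0 + (\<Sum>j\<le>n. of_nat (n choose Suc j) * f (Suc j)) = (\<Sum>j\<le>Suc n. of_nat (n choose j) * f j)"
    by (subst sum.atMost_Suc_shift) simp
  also have "\<dots> = (\<Sum>j\<le>n. of_nat (n choose j) * f j)"
    by (simp add: binomial_eq_0)
  finally show ?thesis
    by (simp add: distrib_left sum.distrib)
qed

locale fair_coins = prob_space M for M :: "'a measure" +
  fixes X :: "nat \<Rightarrow> 'a \<Rightarrow> real"
  assumes indep: "indep_vars (\<lambda>_. borel) X {1..}"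
    and prob_0: "\<And>k. k \<ge> 1 \<Longrightarrow> prob {\<omega> \<in> space M. X k \<omega> = 0} = 1 / 2"
    and prob_1: "\<And>k. k \<ge> 1 \<Longrightarrow> prob {\<omega> \<in> space M. X k \<omega> = 1} = 1 / 2"
begin

lemma random_variable_coin: "k \<ge> 1 \<Longrightarrow> X k \<in> borel_measurable M"
  using indep unfolding indep_vars_def by auto

lemma
  assumes "k \<ge> 1"
  shows AE_coin: "AE \<omega> in M. X k \<omega> \<in> {0, 1}"
    and integrable_coin: "f \<in> borel_measurable borel \<Longrightarrow> integrable M (\<lambda>\<omega>. f (X k \<omega>) :: real)"
    and expectation_coin:
      "f \<in> borel_measurable borel \<Longrightarrow> expectation (\<lambda>\<omega>. f (X k \<omega>) :: real) = (f 0 + f 1) / 2"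
proof -
  note [measurable] = random_variable_coin[OF assms]
  \<comment> \<open>The two probabilities 1/2 already exhaust the mass, so each coin has the finite
    support {0, 1}.\<close>
  have "(\<Sum>a\<in>{0, 1}. prob {\<omega> \<in> space M. X k \<omega> = a}) = 1"
    using prob_0[OF assms] prob_1[OF assms] by simp
  moreover have "{\<omega> \<in> space M. X k \<omega> = a} \<in> events" for a
    by measurable
  ultimately have *: "finite {0, 1::real}" "\<And>a. a \<in> {0, 1} \<Longrightarrow> {\<omega> \<in> space M. X k \<omega> = a} \<in> events"
    "(\<Sum>a\<in>{0, 1}. prob {\<omega> \<in> space M. X k \<omega> = a}) = 1"
    by auto
  show "AE \<omega> in M. X k \<omega> \<in> {0, 1}"
    by (rule AE_finite_support[OF *])
  assume [measurable]: "f \<in> borel_measurable borel"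
  have f: "(\<lambda>\<omega>. f (X k \<omega>)) \<in> borel_measurable M"
    by measurable
  show "integrable M (\<lambda>\<omega>. f (X k \<omega>))"
    by (rule integrable_finite_support[OF * f])
  show "expectation (\<lambda>\<omega>. f (X k \<omega>)) = (f 0 + f 1) / 2"
    by (subst expectation_finite_support[OF * f])
      (simp_all add: prob_0[OF assms] prob_1[OF assms] field_simps)
qed

text \<open>Identical distribution, as the central limit theorem demands: the expectation formula
  applied to \<open>indicator A\<close> gives the same mass to \<open>A\<close> for every
  coin.\<close>

lemma distr_coin:
  assumes "k \<ge> 1" "l \<ge> 1"
  shows "distr M borel (X k) = distr M borel (X l)"
proof (rule measure_eqI)
  note [measurable] = assms[THEN random_variable_coin]
  fix A assume "A \<in> sets (distr M borel (X k))"
  then have [measurable]: "A \<in> sets borel"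
    by simp
  have "emeasure (distr M borel (X j)) A = ennreal ((indicator A 0 + indicator A 1) / 2)" if "j \<ge> 1" for j
  proof -
    note [measurable] = that[THEN random_variable_coin]
    have "emeasure (distr M borel (X j)) A = ennreal (prob (X j -` A \<inter> space M))"
      by (simp add: emeasure_distr emeasure_eq_measure)
    also have "prob (X j -` A \<inter> space M) = expectation (indicator (X j -` A \<inter> space M))"
      by simp
    also have "\<dots> = expectation (\<lambda>\<omega>. indicator A (X j \<omega>))"
      by (intro Bochner_Integration.integral_cong) (auto simp: indicator_def)
    also have "\<dots> = (indicator A 0 + indicator A 1) / 2"
      by (rule expectation_coin[OF that]) simp
    finally show ?thesis .
  qed
  with assms show "emeasure (distr M borel (X k)) A = emeasure (distr M borel (X l)) A"
    by simp
qed simp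

text \<open>Induction on \<open>n\<close>, splitting according to the last coin, which is
  independent of the earlier sum. Integrability and the formula are proved together, since the
  product rule for independent variables needs both factors integrable.\<close>

lemma
  fixes f :: "real \<Rightarrow> real"
  assumes "f \<in> borel_measurable borel"
  shows integrable_coin_sum: "integrable M (\<lambda>\<omega>. f (\<Sum>k=1..n. X k \<omega>))"
    and expectation_coin_sum:
      "expectation (\<lambda>\<omega>. f (\<Sum>k=1..n. X k \<omega>)) = (\<Sum>j\<le>n. real (n choose j) * f (real j)) / 2 ^ n"
proof -
  let ?S = "\<lambda>n \<omega>. \<Sum>k=1..n. X k \<omega>"
  have "integrable M (\<lambda>\<omega>. f (?S n \<omega>)) \<and>
      expectation (\<lambda>\<omega>. f (?S n \<omega>)) = (\<Sum>j\<le>n. real (n choose j) * f (real j)) / 2 ^ n"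
    using assms
  \<comment> \<open>The function varies because the hypothesis is used for the translates of
    \<open>f\<close> by 0 and 1.\<close>
  proof (induction n arbitrary: f)
    case 0
    then show ?case
      by (simp add: prob_space)
  next
    case (Suc n)
    let ?I = "\<lambda>a x. indicator {a} x :: real"
    note [measurable] = \<open>f \<in> borel_measurable borel\<close>
    have [measurable]: "X k \<in> borel_measurable M" if "k \<in> {1..Suc n}" for k
      using that by (intro random_variable_coin) auto
    have [measurable]: "?S n \<in> borel_measurable M" "?S (Suc n) \<in> borel_measurable M"
      "X (Suc n) \<in> borel_measurable M"
      by (auto intro!: borel_measurable_sum random_variable_coin)
    have "indep_var borel (X (Suc n)) borel (?S n)"
    proof (rule indep_vars_sum)
      show "indep_vars (\<lambda>_. borel) X (insert (Suc n) {1..n})"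
        by (rule indep_vars_subset[OF indep]) auto
    qed auto
    then have ind: "indep_var borel (\<lambda>\<omega>. ?I a (X (Suc n) \<omega>)) borel (\<lambda>\<omega>. f (?S n \<omega> + a))" for a
      using indep_var_compose[of borel "X (Suc n)" borel "?S n" "?I a" borel "\<lambda>s. f (s + a)" borel]
      by (simp add: comp_def)
    have IH: "integrable M (\<lambda>\<omega>. f (?S n \<omega> + a))"
      "expectation (\<lambda>\<omega>. f (?S n \<omega> + a)) = (\<Sum>j\<le>n. real (n choose j) * f (real j + a)) / 2 ^ n" for a
      using Suc.IH[of "\<lambda>s. f (s + a)"] by simp_all
    have I: "integrable M (\<lambda>\<omega>. ?I a (X (Suc n) \<omega>))"
      "expectation (\<lambda>\<omega>. ?I a (X (Suc n) \<omega>)) = (?I a 0 + ?I a 1) / 2" for a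
      using integrable_coin[of "Suc n" "?I a"] expectation_coin[of "Suc n" "?I a"] by simp_all
    have prod: "integrable M (\<lambda>\<omega>. ?I a (X (Suc n) \<omega>) * f (?S n \<omega> + a))"
      "expectation (\<lambda>\<omega>. ?I a (X (Suc n) \<omega>) * f (?S n \<omega> + a)) =
        (?I a 0 + ?I a 1) / 2 * ((\<Sum>j\<le>n. real (n choose j) * f (real j + a)) / 2 ^ n)" for a
      using indep_var_integrable[OF ind I(1) IH(1)] indep_var_lebesgue_integral[OF ind I(1) IH(1)]
      unfolding I(2) IH(2) by blast+
    \<comment> \<open>Almost surely exactly one of the two indicators is 1, and it selects the right
      shift of the earlier sum.\<close>
    have eq: "AE \<omega> in M. ?I 0 (X (Suc n) \<omega>) * f (?S n \<omega> + 0) + ?I 1 (X (Suc n) \<omega>) * f (?S n \<omega> + 1)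
        = f (?S (Suc n) \<omega>)"
      by (rule AE_mp[OF AE_coin[of "Suc n"]]) auto
    have int: "integrable M (\<lambda>\<omega>. ?I 0 (X (Suc n) \<omega>) * f (?S n \<omega> + 0) + ?I 1 (X (Suc n) \<omega>) * f (?S n \<omega> + 1))"
      by (intro Bochner_Integration.integrable_add prod)
    have "expectation (\<lambda>\<omega>. f (?S (Suc n) \<omega>)) =
        expectation (\<lambda>\<omega>. ?I 0 (X (Suc n) \<omega>) * f (?S n \<omega> + 0) + ?I 1 (X (Suc n) \<omega>) * f (?S n \<omega> + 1))"
      using eq by (intro integral_cong_AE) auto
    also have "\<dots> = (\<Sum>j\<le>n. real (n choose j) * (f (real j) + f (real (Suc j)))) / 2 ^ Suc n"
      by (subst Bochner_Integration.integral_add[OF prod(1) prod(1)], unfold prod(2))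
        (simp add: distrib_left sum.distrib add_divide_distrib add.commute)
    also have "\<dots> = (\<Sum>j\<le>Suc n. real (Suc n choose j) * f (real j)) / 2 ^ Suc n"
      using sum_binomial_Suc[of n "\<lambda>j. f (real j)"] by (simp only:)
    finally have "expectation (\<lambda>\<omega>. f (?S (Suc n) \<omega>)) = \<dots>" .
    moreover have "integrable M (\<lambda>\<omega>. f (?S (Suc n) \<omega>))"
      by (rule integrable_cong_AE_imp[OF int _ eq]) simp
    ultimately show ?case
      by blast
  qed
  then show "integrable M (\<lambda>\<omega>. f (?S n \<omega>))"
    "expectation (\<lambda>\<omega>. f (?S n \<omega>)) = (\<Sum>j\<le>n. real (n choose j) * f (real j)) / 2 ^ n"
    by auto
qed

lemma normalized_sum_measurable [measurable]: "normalized_sum X n \<in> borel_measurable M"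
  unfolding normalized_sum_def[abs_def]
  by (intro borel_measurable_divide borel_measurable_diff borel_measurable_sum borel_measurable_const)
    (auto intro: random_variable_coin)

section \<open>Weak convergence and passage to the limit\<close>

text \<open>A coin has mean 1/2 and variance 1/4, so the central limit theorem applies to the family
  shifted to start at index 0; its denominator \<open>sqrt (n * (1 / 2)^2)\<close> is
  \<open>sqrt n / 2\<close>.\<close>

lemma weak_conv_normalized_law: "weak_conv_m (normalized_law M X) std_normal_distribution"
proof -
  have "weak_conv_m (\<lambda>n. distr M borel (\<lambda>\<omega>. (\<Sum>i<n. X (Suc i) \<omega> - 1 / 2) / sqrt (n * (1 / 2)\<^sup>2)))
      std_normal_distribution"
  proof (rule central_limit_theorem)
    show "indep_vars (\<lambda>i. borel) (\<lambda>i. X (Suc i)) UNIV"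
    proof -
      \<comment> \<open>Independence is reindexed by grouping the coins into disjoint singleton
        blocks and then reading off the single coordinate of each block.\<close>
      have "indep_vars (\<lambda>i. PiM {Suc i} (\<lambda>_. borel)) (\<lambda>i \<omega>. restrict (\<lambda>k. X k \<omega>) {Suc i}) UNIV"
        by (rule indep_vars_restrict[OF indep]) (auto simp: disjoint_family_on_def)
      from indep_vars_compose2[OF this, of "\<lambda>i f. f (Suc i)" "\<lambda>_. borel"] show ?thesis
        by simp
    qed
    show mean: "expectation (X (Suc n)) = 1 / 2" for n
      using expectation_coin[of "Suc n" "\<lambda>x. x"] by simp
    show "variance (X (Suc n)) = (1 / 2)\<^sup>2" for n
      using expectation_coin[of "Suc n" "\<lambda>x. (x - 1 / 2)\<^sup>2"]
      unfolding mean by (simp add: power2_eq_square)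
    show "integrable M (\<lambda>x. (X (Suc n) x)\<^sup>2)" for n
      using integrable_coin[of "Suc n" "\<lambda>x. x\<^sup>2"] by simp
    show "distr M borel (X (Suc n)) = distr M borel (X 1)" for n
      by (rule distr_coin) auto
  qed simp
  moreover have "(\<Sum>i<n. X (Suc i) \<omega> - 1 / 2) / sqrt (n * (1 / 2)\<^sup>2) = normalized_sum X n \<omega>" for n \<omega>
  proof -
    have "(\<Sum>i<n. X (Suc i) \<omega>) = (\<Sum>k=1..n. X k \<omega>)"
      by (simp add: sum.atLeast1_atMost_eq)
    then show ?thesis
      by (simp add: normalized_sum_def sum_subtractf real_sqrt_mult power2_eq_square real_sqrt_divide)
  qed
  ultimately show ?thesis
    by (simp add: normalized_law_def[abs_def])
qed

lemma
  fixes f :: "real \<Rightarrow> real"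
  assumes [measurable]: "f \<in> borel_measurable borel"
  shows integrable_normalized_law: "integrable (normalized_law M X n) f"
    and integral_normalized_law_four_square:
      "(LINT x|normalized_law M X (4 * n\<^sup>2). f x) =
        (\<Sum>j\<le>4 * n\<^sup>2. real ((4 * n\<^sup>2) choose j) * f ((real j - 2 * (real n)\<^sup>2) / real n)) / 2 ^ (4 * n\<^sup>2)"
proof -
  have "integrable M (\<lambda>\<omega>. f (normalized_sum X n \<omega>))"
    unfolding normalized_sum_def by (rule integrable_coin_sum) measurable
  then show "integrable (normalized_law M X n) f"
    by (simp add: normalized_law_def integrable_distr_eq)
  \<comment> \<open>Along this subsequence the scale is the integer \<open>n\<close> and the centre
    the integer \<open>2 * n^2\<close>.\<close>
  have sqrt: "sqrt (real (4 * n\<^sup>2)) / 2 = real n" "real (4 * n\<^sup>2) / 2 = 2 * (real n)\<^sup>2"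
    by (simp_all add: real_sqrt_mult)
  have "(LINT x|normalized_law M X (4 * n\<^sup>2). f x) =
      expectation (\<lambda>\<omega>. f (normalized_sum X (4 * n\<^sup>2) \<omega>))"
    by (simp add: normalized_law_def integral_distr)
  also have "\<dots> = (\<Sum>j\<le>4 * n\<^sup>2. real ((4 * n\<^sup>2) choose j) * f ((real j - 2 * (real n)\<^sup>2) / real n)) / 2 ^ (4 * n\<^sup>2)"
    unfolding normalized_sum_def sqrt by (rule expectation_coin_sum) measurable
  finally show "(LINT x|normalized_law M X (4 * n\<^sup>2). f x) = \<dots>" .
qed

text \<open>Weak convergence extends to bounded test functions that are continuous almost everywhere
  for the limit law. Here the discontinuities lie in {0}, a null set because the limit has a
  density.\<close>

lemma integral_halfline_truncation_tendsto:
  fixes g :: "real \<Rightarrow> real"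
  assumes [measurable]: "g \<in> borel_measurable borel" and cont: "continuous_on {0..} g" and "0 \<le> R"
  shows "(\<lambda>n. LINT x|normalized_law M X n. halfline_truncation g R x)
    \<longlonglongrightarrow> (LINT x|std_normal_distribution. halfline_truncation g R x)"
proof -
  obtain B where "\<And>x. norm (halfline_truncation g R x) \<le> B"
    using bounded_halfline_truncation[OF assms(2,3)] by blast
  moreover have "emeasure std_normal_distribution {x. \<not> isCont (halfline_truncation g R) x} = 0"
  proof -
    have "emeasure std_normal_distribution {x. \<not> isCont (halfline_truncation g R) x}
        \<le> emeasure std_normal_distribution {0}"
      using isCont_halfline_truncation[OF assms(2,3)] by (intro emeasure_mono) auto
    also have "\<dots> = 0"
      by (subst emeasure_density) (auto simp: nn_integral_indicator_singleton)
    finally show ?thesis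
      by simp
  qed
  moreover have "real_distribution (normalized_law M X n)" for n
    unfolding normalized_law_def by (rule real_distribution_distr) simp
  ultimately show ?thesis
    using weak_conv_normalized_law real_dist_normal_dist
    by (intro weak_conv_imp_bdd_ae_continuous_conv) auto
qed

text \<open>The error is split into two halves: \<open>R\<close> is fixed first so that the excess
  contributes less than \<open>e / 2\<close> for every \<open>n >= 1\<close>, and only then is
  \<open>n\<close> taken large for the truncated part.\<close>

lemma set_integral_normalized_law_tendsto:
  fixes g :: "real \<Rightarrow> real"
  assumes int: "integrable std_normal_distribution g" and cont: "continuous_on {0..} g"
    and "0 \<le> r" and mono: "mono_on {r..} g"
  shows "(\<lambda>n. LINT x:{0..}|normalized_law M X (4 * n\<^sup>2). g x)
    \<longlonglongrightarrow> (LINT x:{0..}|std_normal_distribution. g x)"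
proof (rule LIMSEQ_I)
  fix e :: real assume "0 < e"
  let ?\<mu> = "\<lambda>n. normalized_law M X (4 * n\<^sup>2)" and ?\<gamma> = std_normal_distribution
  \<comment> \<open>The added 1 ensures \<open>C >= 1\<close>, so \<open>C\<close> times the
    Gaussian excess bounds both the binomial and the Gaussian excess. Two nonnegative numbers below
    \<open>e / 2\<close> differ by less than \<open>e / 2\<close>.\<close>
  define C where "C = exp 3 * sqrt (2 * pi) / 2 + 1"
  have "C > 0"
    by (simp add: C_def add_pos_pos)
  have [measurable]: "g \<in> borel_measurable borel"
    using int by (simp add: borel_measurable_integrable[of std_normal_distribution, simplified])
  have \<gamma>: "prob_space ?\<gamma>" "sets ?\<gamma> = sets borel"
    by (simp_all add: prob_space_normal_density)
  have "(\<lambda>i. LINT x|?\<gamma>. tail_excess g (r + real i) x) \<longlonglongrightarrow> 0"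
    using \<gamma> int mono by (rule integral_tail_excess_tendsto_0)
  then have "\<forall>\<^sub>F i in sequentially. (LINT x|?\<gamma>. tail_excess g (r + real i) x) < e / (2 * C)"
    using \<open>0 < e\<close> \<open>0 < C\<close> by (intro order_tendstoD(2)) auto
  then obtain i where i: "(LINT x|?\<gamma>. tail_excess g (r + real i) x) < e / (2 * C)"
    by (auto dest: eventually_happens)
  define R where "R = r + real i"
  have R: "0 \<le> R" "mono_on {R..} g"
    using \<open>0 \<le> r\<close> by (auto simp: R_def intro: mono_on_subset[OF mono])
  let ?T = "halfline_truncation g R" and ?H = "tail_excess g R"
  have intH: "integrable ?\<gamma> ?H"
    using \<gamma> int by (rule integrable_tail_excess)
  have intT: "integrable ?\<gamma> ?T"
  proof -
    obtain B where "\<And>x. norm (?T x) \<le> B"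
      using bounded_halfline_truncation[OF cont R(1)] by blast
    then show ?thesis
      using \<gamma> by (intro finite_measure.integrable_const_bound[where B = B])
        (auto simp: prob_space_def)
  qed
  have split: "(LINT x:{0..}|\<nu>. g x) = (LINT x|\<nu>. ?T x) + (LINT x|\<nu>. ?H x)"
    if "integrable \<nu> ?T" "integrable \<nu> ?H" for \<nu> :: "real measure"
    using that halfline_truncation_plus_tail_excess[OF R(1), of _ g]
    by (simp add: set_lebesgue_integral_def)
  have "(\<lambda>n. LINT x|?\<mu> n. ?T x) \<longlonglongrightarrow> (LINT x|?\<gamma>. ?T x)"
  proof -
    have "strict_mono (\<lambda>n::nat. 4 * n\<^sup>2)"
      by (auto simp: strict_mono_def power_strict_mono)
    from LIMSEQ_subseq_LIMSEQ[OF integral_halfline_truncation_tendsto[of g R] this]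
    show ?thesis
      using cont R(1) by (simp add: comp_def)
  qed
  then obtain N where N: "\<And>n. n \<ge> N \<Longrightarrow> \<bar>(LINT x|?\<mu> n. ?T x) - (LINT x|?\<gamma>. ?T x)\<bar> < e / 2"
    using LIMSEQ_D[of _ _ "e / 2"] \<open>0 < e\<close> by (metis half_gt_zero real_norm_def)
  \<comment> \<open>The 1 in the maximum excludes \<open>n = 0\<close>, where the lattice of mesh
    \<open>1 / n\<close> makes no sense.\<close>
  have "norm ((LINT x:{0..}|?\<mu> n. g x) - (LINT x:{0..}|?\<gamma>. g x)) < e" if "n \<ge> max N 1" for n
  proof -
    have "?H x = 0" if "x < 0" for x
      using that R(1) by (simp add: tail_excess_def)
    then have "(LINT x|?\<mu> n. ?H x) \<le> (C - 1) * (LINT x|?\<gamma>. ?H x)"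
      unfolding integral_normalized_law_four_square[OF tail_excess_measurable[OF \<open>g \<in> borel_measurable borel\<close>]]
      using that intH mono_tail_excess[OF R(2)] tail_excess_nonneg[OF R(2)]
        binomial_integral_le_normal_integral[of n ?H]
      by (simp add: C_def)
    moreover have "0 \<le> (LINT x|?\<mu> n. ?H x)" "0 \<le> (LINT x|?\<gamma>. ?H x)"
      using tail_excess_nonneg[OF R(2)] by simp_all
    moreover from this have "(LINT x|?\<gamma>. ?H x) \<le> C * (LINT x|?\<gamma>. ?H x)"
      by (simp add: C_def distrib_right)
    moreover have "C * (LINT x|?\<gamma>. ?H x) < e / 2"
      using i \<open>0 < C\<close> by (simp add: R_def field_simps)
    ultimately have "\<bar>(LINT x|?\<mu> n. ?H x) - (LINT x|?\<gamma>. ?H x)\<bar> < e / 2"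
      unfolding left_diff_distrib abs_less_iff by linarith
    moreover have "(LINT x:{0..}|?\<mu> n. g x) = (LINT x|?\<mu> n. ?T x) + (LINT x|?\<mu> n. ?H x)"
      by (intro split integrable_normalized_law) measurable
    moreover have "\<bar>(LINT x|?\<mu> n. ?T x) - (LINT x|?\<gamma>. ?T x)\<bar> < e / 2"
      using N that by simp
    ultimately show ?thesis
      using split[OF intT intH] unfolding real_norm_def by linarith
  qed
  then show "\<exists>N. \<forall>n\<ge>N. norm ((LINT x:{0..}|?\<mu> n. g x) - (LINT x:{0..}|?\<gamma>. g x)) < e"
    by blast
qed

end

theorem theorem5p12:
  fixes M :: "'a measure" and X :: "nat \<Rightarrow> 'a \<Rightarrow> real"
    and g :: "real \<Rightarrow> real" and x\<^sub>0 :: real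
  assumes "prob_space M"
    and "prob_space.indep_vars M (\<lambda>_. borel) X {1..}"
    and "\<And>k. k \<ge> 1 \<Longrightarrow> measure M {\<omega> \<in> space M. X k \<omega> = 0} = 1 / 2"
    and "\<And>k. k \<ge> 1 \<Longrightarrow> measure M {\<omega> \<in> space M. X k \<omega> = 1} = 1 / 2"
    and "integrable std_normal_distribution g"
    and "C1_halfline g"
    and "x\<^sub>0 \<ge> 0"
    and "strict_mono_on {x\<^sub>0..} g"
  shows "(\<lambda>n::nat. LINT x:{0..}|normalized_law M X (4 * n^2). g x)
           \<longlonglongrightarrow> (LINT x:{0..}|std_normal_distribution. g x)"
proof -
  interpret fair_coins M X
    using assms(1-4) by (intro fair_coins.intro fair_coins_axioms.intro)
  \<comment> \<open>The one-sided derivative at 0 gives continuity relative to the half line,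
    endpoint included.\<close>
  have "continuous_on {0..} g"
    using assms(6) unfolding C1_halfline_def by (auto intro: DERIV_continuous_on)
  then show ?thesis
    using assms(5,7,8) by (intro set_integral_normalized_law_tendsto strict_mono_on_imp_mono_on)
qed

end
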